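(* Let $X$ be a point-transitive geodesic metric space with $\operatorname{asdim}X=n$, where $2\le n<\infty$. If $X$ is net-compact and has at least one infinite geodesic, then $X$ contains an $n$-asymptotic Cantor manifold, i.e. there is a subset of $X$ which, with the restricted metric, is an $n$-asymptotic Cantor manifold.
   Context: Asymptotic dimension: for a metric space $X$ and an integer $n\ge 0$, $\operatorname{asdim} X\le n$ iff for every $R>0$ there is a uniformly bounded covering $\mathcal U$ of $X$ (i.e. $\sup_{U\in\mathcal U}\operatorname{diam}U<\infty$) such that every ball of radius $R$ in $X$ intersects at most $n+1$ elements of $\mathcal U$. Subsets carry the restricted metric. For $A\subseteq X$, $N_R(A)$ is the set of points of $X$ at distance at most $R$ from $A$. Point-transitive: for any two points $x,y\in X$ there is an isometry $f$ of $X$ with $f(x)=y$. A subset $\Sigma\subseteq X$ is a $c$-net of $X$ ($c\ge 0$) if every element of $X$ is at distance at most $c$ from $\Sigma$. $X$ is net-compact if there is a $c$-net $\Sigma$ of $X$, for some $c\ge 0$, such that every ball in $X$ contains finitely many elements of $\Sigma$. An infinite geodesic is an isometrically embedded ray $[0,\infty)\to X$. Coarse separation: let $X$ be a metric space and $K\subseteq X$. A component $C$ of $X\setminus N_R(K)$ is deep if $C$ is not contained in $N_{R'}(K)$ for any $R'>0$. The set $K$ coarsely separates $X$ if there is an $R>0$ such that $X\setminus N_R(K)$ has at least two deep connected components. Asymptotic Cantor manifold: a connected metric space $X$ with $\operatorname{asdim}X=n$, $n\ge 2$, is an $n$-asymptotic Cantor manifold if $X$ cannot be coarsely separated by any subset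 of asymptotic dimension $k$ with $k\le n-2$. *)

theory Defs
  imports "HOL-Analysis.Analysis" "HOL-Library.Extended_Nat"
begin

text \<open>
  A metric space is a set \<open>X\<close> in a type of class \<^class>\<open>metric_space\<close>, with the restricted metric.
  All notions below depend only on the distances between points of \<open>X\<close>, so
  that a subset \<open>M\<close> of \<open>X\<close> with the restricted metric is obtained by replacing \<open>X\<close> with \<open>M\<close>.
\<close>

definition isometric_on :: "'a::metric_space set \<Rightarrow> ('a \<Rightarrow> 'b::metric_space) \<Rightarrow> bool" where
  "isometric_on A f \<longleftrightarrow> (\<forall>x\<in>A. \<forall>y\<in>A. dist (f x) (f y) = dist x y)"

definition point_transitive :: "'a::metric_space set \<Rightarrow> bool" where
  "point_transitive X \<longleftrightarrow>
     (\<forall>x\<in>X. \<forall>y\<in>X. \<exists>f. isometric_on X f \<and> f ` X = X \<and> f x = y)"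

definition geodesic_space :: "'a::metric_space set \<Rightarrow> bool" where
  "geodesic_space X \<longleftrightarrow>
     (\<forall>x\<in>X. \<forall>y\<in>X. \<exists>g :: real \<Rightarrow> 'a. isometric_on {0..dist x y} g \<and>
        g ` {0..dist x y} \<subseteq> X \<and> g 0 = x \<and> g (dist x y) = y)"

definition has_infinite_geodesic :: "'a::metric_space set \<Rightarrow> bool" where
  "has_infinite_geodesic X \<longleftrightarrow>
     (\<exists>g :: real \<Rightarrow> 'a. isometric_on {0..} g \<and> g ` {0..} \<subseteq> X)"

text \<open>
  The neighbourhood \<open>N\<^sub>R(A)\<close> taken in \<open>X\<close>.  The condition \<open>A \<noteq> {}\<close> is needed because
  \<^const>\<open>infdist\<close> to the empty set is \<open>0\<close>, whereas no point is at finite distance from it.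
\<close>

definition nbhd :: "'a::metric_space set \<Rightarrow> real \<Rightarrow> 'a set \<Rightarrow> 'a set" where
  "nbhd X R A = {x \<in> X. A \<noteq> {} \<and> infdist x A \<le> R}"

definition net :: "'a::metric_space set \<Rightarrow> real \<Rightarrow> 'a set \<Rightarrow> bool" where
  "net X c \<Sigma> \<longleftrightarrow> \<Sigma> \<subseteq> X \<and> X \<subseteq> nbhd X c \<Sigma>"

definition net_compact :: "'a::metric_space set \<Rightarrow> bool" where
  "net_compact X \<longleftrightarrow>
     (\<exists>c\<ge>0. \<exists>\<Sigma>. net X c \<Sigma> \<and> (\<forall>x\<in>X. \<forall>r. finite (cball x r \<inter> \<Sigma>)))"

text \<open>
  Boundedness of each member is required separately since \<^const>\<open>diameter\<close> has no meaningful
  value on unbounded sets.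
\<close>

definition uniformly_bounded :: "'a::metric_space set set \<Rightarrow> bool" where
  "uniformly_bounded \<U> \<longleftrightarrow> (\<exists>D. \<forall>U\<in>\<U>. bounded U \<and> diameter U \<le> D)"

text \<open>
  Members of a covering are subsets of \<open>X\<close>, so that they meet \<open>cball x R\<close> exactly where they meet
  the ball of radius \<open>R\<close> in \<open>X\<close>.  As \<open>R\<close> is arbitrary, open balls would give the same notion.
\<close>

definition asdim_le :: "'a::metric_space set \<Rightarrow> nat \<Rightarrow> bool" where
  "asdim_le X n \<longleftrightarrow>
     (\<forall>R>0. \<exists>\<U>. \<Union>\<U> = X \<and> uniformly_bounded \<U> \<and>
        (\<forall>x\<in>X. finite {U \<in> \<U>. U \<inter> cball x R \<noteq> {}} \<and>
               card {U \<in> \<U>. U \<inter> cball x R \<noteq> {}} \<le> n + 1))"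

text \<open>The value is \<open>\<infinity>\<close> if no \<open>n\<close> qualifies; the empty space gets dimension \<open>0\<close>.\<close>

definition asdim :: "'a::metric_space set \<Rightarrow> enat" where
  "asdim X = (INF n \<in> {n. asdim_le X n}. enat n)"

definition deep :: "'a::metric_space set \<Rightarrow> 'a set \<Rightarrow> 'a set \<Rightarrow> bool" where
  "deep X K C \<longleftrightarrow> (\<forall>R>0. \<not> C \<subseteq> nbhd X R K)"

definition coarsely_separates :: "'a::metric_space set \<Rightarrow> 'a set \<Rightarrow> bool" where
  "coarsely_separates K X \<longleftrightarrow>
     (\<exists>R>0. \<exists>C \<in> components (X - nbhd X R K). \<exists>D \<in> components (X - nbhd X R K).
        C \<noteq> D \<and> deep X K C \<and> deep X K D)"

definition asymptotic_Cantor_manifold :: "nat \<Rightarrow> 'a::metric_space set \<Rightarrow> bool" where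
  "asymptotic_Cantor_manifold n X \<longleftrightarrow>
     connected X \<and> n \<ge> 2 \<and> asdim X = enat n \<and>
     (\<forall>K k. K \<subseteq> X \<and> asdim K = enat k \<and> k \<le> n - 2 \<longrightarrow> \<not> coarsely_separates K X)"

end

theory Submission
  imports Defs "HOL-Complex_Analysis.Great_Picard"
begin

text \<open>
  Let \<open>\<gamma>\<close> be an infinite geodesic and \<open>M\<close> the union of \<open>\<gamma>\<close> with the balls of radius \<open>k\<close> about
  \<open>\<gamma>((k+1)\<^sup>2)\<close>.  These balls are so sparse that the sphere of radius \<open>(k+1)(k+2)\<close> about \<open>\<gamma>(0)\<close>
  meets \<open>M\<close> in the single point \<open>\<gamma>((k+1)(k+2))\<close>.  Hence any two unbounded connected subsets of
  \<open>M\<close> intersect, and since bounded components are never deep, nothing coarsely separates \<open>M\<close>.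
  On the other hand \<open>M\<close> contains arbitrarily large balls of \<open>X\<close>.  Moving them to a base point by
  isometries, a covering of \<open>M\<close> induces colourings of larger and larger balls of the net, and a
  pointwise limit of these yields a covering of \<open>X\<close> of the same multiplicity, so that
  \<open>asdim M = asdim X\<close>.
\<close>

section \<open>Subspaces and balls of geodesic spaces\<close>

lemma asdim_le_subset:
  assumes "asdim_le X n" "M \<subseteq> X"
  shows "asdim_le M n"
  unfolding asdim_le_def
proof (intro allI impI)
  fix R :: real assume "R > 0"
  from assms(1)[unfolded asdim_le_def, rule_format, OF this]
  obtain \<U> where un: "\<Union>\<U> = X" and ub: "uniformly_bounded \<U>"
    and mult: "\<forall>x\<in>X. finite {U \<in> \<U>. U \<inter> cball x R \<noteq> {}} \<and>
      card {U \<in> \<U>. U \<inter> cball x R \<noteq> {}} \<le> n + 1"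
    by (elim exE conjE)
  let ?V = "(\<lambda>U. U \<inter> M) ` \<U>"
  have "\<Union>?V = M" using un assms(2) by auto
  moreover have "uniformly_bounded ?V"
  proof -
    obtain D where D: "\<And>U. U \<in> \<U> \<Longrightarrow> bounded U \<and> diameter U \<le> D"
      using ub unfolding uniformly_bounded_def by blast
    have "bounded (U \<inter> M) \<and> diameter (U \<inter> M) \<le> D" if "U \<in> \<U>" for U
      using D[OF that] diameter_subset[of "U \<inter> M" U] bounded_subset[of U "U \<inter> M"] by force
    then show ?thesis unfolding uniformly_bounded_def by blast
  qed
  moreover have "finite {V \<in> ?V. V \<inter> cball x R \<noteq> {}} \<and> card {V \<in> ?V. V \<inter> cball x R \<noteq> {}} \<le> n + 1"
    if "x \<in> M" for x
  proof -
    have fin: "finite {U \<in> \<U>. U \<inter> cball x R \<noteq> {}}"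
      and crd: "card {U \<in> \<U>. U \<inter> cball x R \<noteq> {}} \<le> n + 1"
      using mult that assms(2) by blast+
    have sub: "{V \<in> ?V. V \<inter> cball x R \<noteq> {}} \<subseteq> (\<lambda>U. U \<inter> M) ` {U \<in> \<U>. U \<inter> cball x R \<noteq> {}}"
      by auto
    show ?thesis
      using finite_surj[OF fin sub] surj_card_le[OF fin sub] crd by auto
  qed
  ultimately show "\<exists>\<V>. \<Union>\<V> = M \<and> uniformly_bounded \<V> \<and>
      (\<forall>x\<in>M. finite {U \<in> \<V>. U \<inter> cball x R \<noteq> {}} \<and> card {U \<in> \<V>. U \<inter> cball x R \<noteq> {}} \<le> n + 1)"
    by blast
qed

text \<open>A geodesic from the centre to a point of the ball never leaves the ball, so every point
  is joined to the centre inside it.\<close>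

lemma connected_cball_geodesic_space:
  assumes "geodesic_space X" "x \<in> X"
  shows "connected (X \<inter> cball x r)"
proof (cases "r \<ge> 0")
  case False
  then show ?thesis by simp
next
  case True
  have ex: "\<exists>S. connected S \<and> x \<in> S \<and> y \<in> S \<and> S \<subseteq> X \<inter> cball x r"
    if y: "y \<in> X" "dist x y \<le> r" for y
  proof -
    obtain g :: "real \<Rightarrow> 'a" where g: "isometric_on {0..dist x y} g"
      "g ` {0..dist x y} \<subseteq> X" "g 0 = x" "g (dist x y) = y"
      using assms y(1) unfolding geodesic_space_def by blast
    have d: "dist (g s) (g t) = dist s t" if "s \<in> {0..dist x y}" "t \<in> {0..dist x y}" for s t
      using g(1) that unfolding isometric_on_def by blast
    have "continuous_on {0..dist x y} g"
      unfolding continuous_on_iff using d by metis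
    then have "connected (g ` {0..dist x y})"
      by (intro connected_continuous_image) auto
    moreover have "x \<in> g ` {0..dist x y}" "y \<in> g ` {0..dist x y}"
      using g(3,4) imageI[of 0 "{0..dist x y}" g] imageI[of "dist x y" "{0..dist x y}" g] by simp_all
    moreover have "g t \<in> cball x r" if "t \<in> {0..dist x y}" for t
      using d[of 0 t] that g(3) y(2) by (auto simp: dist_real_def)
    ultimately show ?thesis using g(2) by blast
  qed
  show ?thesis
    unfolding connected_iff_connected_component
  proof (intro ballI)
    fix y z assume yz: "y \<in> X \<inter> cball x r" "z \<in> X \<inter> cball x r"
    have "connected_component (X \<inter> cball x r) x y" "connected_component (X \<inter> cball x r) x z"
      using ex[of y] ex[of z] yz unfolding connected_component_def by auto
    then show "connected_component (X \<inter> cball x r) y z"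
      by (meson connected_component_sym connected_component_trans)
  qed
qed

section \<open>Asymptotic dimension via colourings of a net\<close>

text \<open>Thickening the classes of \<open>r\<close> gives the covering of \<open>X\<close>. The
  multiplicity bound is phrased as a pigeonhole condition on finite sets of net points, because such
  a condition survives pointwise limits of colourings.\<close>

lemma asdim_leI_net:
  assumes net: "net X c \<Sigma>" and c: "0 \<le> c"
    and ex: "\<And>\<rho>. \<rho> > 0 \<Longrightarrow> \<exists>r D. equiv \<Sigma> r \<and> (\<forall>(s,t)\<in>r. dist s t \<le> D) \<and>
      (\<forall>T\<subseteq>\<Sigma>. finite T \<and> card T = m + 2 \<and> (\<forall>s\<in>T. \<forall>t\<in>T. dist s t \<le> \<rho>) \<longrightarrow>
        (\<exists>s\<in>T. \<exists>t\<in>T. s \<noteq> t \<and> (s,t) \<in> r))"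
  shows "asdim_le X m"
  unfolding asdim_le_def
proof (intro allI impI)
  fix R :: real assume R: "R > 0"
  \<comment> \<open>Net points within \<open>R + (c + 1)\<close> of a common point are at most this
    far apart.\<close>
  define \<rho> where "\<rho> = 2 * (R + (c + 1))"
  have "\<rho> > 0" using R c by (simp add: \<rho>_def)
  from ex[OF this] obtain r D where eq: "equiv \<Sigma> r" and D: "\<forall>(s,t)\<in>r. dist s t \<le> D"
    and pig: "\<forall>T\<subseteq>\<Sigma>. finite T \<and> card T = m + 2 \<and> (\<forall>s\<in>T. \<forall>t\<in>T. dist s t \<le> \<rho>) \<longrightarrow>
      (\<exists>s\<in>T. \<exists>t\<in>T. s \<noteq> t \<and> (s,t) \<in> r)"
    by (elim exE conjE)
  \<comment> \<open>The infimum in \<open>infdist\<close> need not be attained, so a net point is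
    only guaranteed within \<open>c + 1\<close>, not within \<open>c\<close>.\<close>
  define P where "P E = {x \<in> X. \<exists>s\<in>E. dist x s \<le> c + 1}" for E
  let ?U = "P ` (\<Sigma> // r)"
  have near: "\<exists>s\<in>\<Sigma>. dist x s \<le> c + 1" if "x \<in> X" for x
  proof -
    have "\<Sigma> \<noteq> {}" "infdist x \<Sigma> \<le> c" using net that unfolding net_def nbhd_def by auto
    then have "(INF a\<in>\<Sigma>. dist x a) < c + 1" "\<Sigma> \<noteq> {}" by (auto simp: infdist_def)
    then show ?thesis using cInf_lessD[of "(\<lambda>a. dist x a) ` \<Sigma>" "c + 1"] by force
  qed
  have "\<Union>?U = X"
  proof
    show "X \<subseteq> \<Union>?U"
    proof
      fix x assume x: "x \<in> X"
      then obtain s where s: "s \<in> \<Sigma>" "dist x s \<le> c + 1" using near by blast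
      then have "x \<in> P (r `` {s})"
        using x equiv_class_self[OF eq] unfolding P_def by blast
      then show "x \<in> \<Union>?U" using quotientI[OF s(1), of r] by blast
    qed
  qed (auto simp: P_def)
  moreover have "uniformly_bounded ?U"
  proof -
    have "bounded (P E) \<and> diameter (P E) \<le> D + 2 * (c + 1)" if E: "E \<in> \<Sigma> // r" for E
    proof -
      have d: "dist x y \<le> D + 2 * (c + 1)" if xy: "x \<in> P E" "y \<in> P E" for x y
      proof -
        obtain s t where st: "s \<in> E" "t \<in> E" "dist x s \<le> c + 1" "dist y t \<le> c + 1"
          using xy unfolding P_def by blast
        have "(s,t) \<in> r"
          using in_quotient_imp_in_rel[OF eq E, of s t] st(1,2) by simp
        then have "dist s t \<le> D" using D by blast
        then show ?thesis
          using st dist_triangle[of x y s] dist_triangle2[of s y t] by (simp add: algebra_simps)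
      qed
      \<comment> \<open>The supremum bound on \<open>diameter\<close> needs a nonempty set; a class
        is nonempty and its members lie in its thickening.\<close>
      have "P E \<noteq> {}"
        using in_quotient_imp_non_empty[OF eq E] in_quotient_imp_subset[OF eq E] net c
        unfolding P_def net_def by force
      then show ?thesis
        using d unfolding bounded_two_points diameter_def by (auto intro!: cSUP_least)
    qed
    then show ?thesis unfolding uniformly_bounded_def by blast
  qed
  moreover have "finite {U \<in> ?U. U \<inter> cball x R \<noteq> {}} \<and> card {U \<in> ?U. U \<inter> cball x R \<noteq> {}} \<le> m + 1"
    if "x \<in> X" for x
  proof (rule ccontr)
    let ?S = "{U \<in> ?U. U \<inter> cball x R \<noteq> {}}"
    assume "\<not> (finite ?S \<and> card ?S \<le> m + 1)"
    \<comment> \<open>Too many members in either sense leave \<open>m + 2\<close> distinct ones.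
      Each yields a nearby net point in its class, and distinct members have distinct classes, so
      these net points are pairwise inequivalent.\<close>
    then have "infinite ?S \<or> m + 2 \<le> card ?S" by auto
    then obtain F where F: "F \<subseteq> ?S" "card F = m + 2" "finite F"
    proof
      assume "infinite ?S"
      then show thesis using infinite_arbitrarily_large[of ?S "m + 2"] that by blast
    next
      assume "m + 2 \<le> card ?S"
      then show thesis using obtain_subset_with_card_n[of "m + 2" ?S] that by blast
    qed
    have "\<exists>E s. E \<in> \<Sigma> // r \<and> U = P E \<and> s \<in> E \<and> dist x s \<le> R + (c + 1)" if U: "U \<in> F" for U
    proof -
      obtain E y where E: "E \<in> \<Sigma> // r" "U = P E" "y \<in> P E" "dist x y \<le> R"
        using U F(1) by fastforce
      then obtain s where s: "s \<in> E" "dist y s \<le> c + 1" unfolding P_def by blast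
      have "dist x s \<le> R + (c + 1)" using E(4) s(2) dist_triangle[of x s y] by linarith
      then show ?thesis using E s by blast
    qed
    then obtain e \<sigma> where e: "\<And>U. U \<in> F \<Longrightarrow> e U \<in> \<Sigma> // r" "\<And>U. U \<in> F \<Longrightarrow> U = P (e U)"
      and \<sigma>: "\<And>U. U \<in> F \<Longrightarrow> \<sigma> U \<in> e U" "\<And>U. U \<in> F \<Longrightarrow> dist x (\<sigma> U) \<le> R + (c + 1)"
      by metis
    have sep: "U = V" if "U \<in> F" "V \<in> F" "(\<sigma> U, \<sigma> V) \<in> r" for U V
      using that e \<sigma> quotient_eqI[OF eq, of "e U" "e V" "\<sigma> U" "\<sigma> V"] by metis
    have refl: "(s,s) \<in> r" if "s \<in> \<Sigma>" for s
      using eq that unfolding equiv_def refl_on_def by blast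
    have in\<Sigma>: "\<sigma> U \<in> \<Sigma>" if "U \<in> F" for U
      using in_quotient_imp_subset[OF eq e(1)[OF that]] \<sigma>(1)[OF that] by blast
    have inj: "inj_on \<sigma> F"
      by (rule inj_onI) (metis sep refl in\<Sigma>)
    have "dist s t \<le> \<rho>" if "s \<in> \<sigma> ` F" "t \<in> \<sigma> ` F" for s t
    proof -
      have "dist x s \<le> R + (c + 1)" "dist x t \<le> R + (c + 1)" using that \<sigma>(2) by auto
      then show ?thesis using dist_triangle3[of s t x] unfolding \<rho>_def by (simp add: algebra_simps)
    qed
    moreover have "card (\<sigma> ` F) = m + 2" using card_image[OF inj] F(2) by simp
    moreover have "\<sigma> ` F \<subseteq> \<Sigma>" "finite (\<sigma> ` F)" using in\<Sigma> F(3) by auto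
    ultimately have "\<exists>s\<in>\<sigma> ` F. \<exists>t\<in>\<sigma> ` F. s \<noteq> t \<and> (s,t) \<in> r"
      using pig[rule_format, of "\<sigma> ` F"] F(3) by simp
    then show False using sep by blast
  qed
  ultimately show "\<exists>\<U>. \<Union>\<U> = X \<and> uniformly_bounded \<U> \<and>
      (\<forall>x\<in>X. finite {U \<in> \<U>. U \<inter> cball x R \<noteq> {}} \<and> card {U \<in> \<U>. U \<inter> cball x R \<noteq> {}} \<le> m + 1)"
    by blast
qed

text \<open>The colours range over an arbitrary set and need not converge. The relation of having
  equal colours is a 0-1 function on a countable set of pairs, and a diagonal subsequence makes it
  converge at every pair.\<close>

lemma colouring_limit:
  fixes h :: "nat \<Rightarrow> 'a \<Rightarrow> 'b"
  assumes "countable S"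
  obtains \<phi> r where "strict_mono (\<phi> :: nat \<Rightarrow> nat)" "equiv S r"
    "\<And>s t. s \<in> S \<Longrightarrow> t \<in> S \<Longrightarrow> \<forall>\<^sub>F n in sequentially. (s,t) \<in> r \<longleftrightarrow> h (\<phi> n) s = h (\<phi> n) t"
proof -
  define f :: "nat \<Rightarrow> 'a \<times> 'a \<Rightarrow> real"
    where "f n = (\<lambda>(s,t). if h n s = h n t then 1 else 0)" for n
  obtain \<phi> where \<phi>: "strict_mono (\<phi> :: nat \<Rightarrow> nat)"
    and lim: "\<And>z. z \<in> S \<times> S \<Longrightarrow> \<exists>l. (\<lambda>n. f (\<phi> n) z) \<longlonglongrightarrow> l"
  proof (rule function_convergent_subsequence[of "S \<times> S" f 1])
    show "countable (S \<times> S)" using assms by simp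
    show "norm (f n z) \<le> 1" for n z by (simp add: f_def split: prod.splits)
  qed blast
  define r where "r = {(s,t) \<in> S \<times> S. \<forall>\<^sub>F n in sequentially. h (\<phi> n) s = h (\<phi> n) t}"
  have ev: "\<forall>\<^sub>F n in sequentially. (s,t) \<in> r \<longleftrightarrow> h (\<phi> n) s = h (\<phi> n) t"
    if st: "s \<in> S" "t \<in> S" for s t
  proof -
    obtain l where l: "(\<lambda>n. f (\<phi> n) (s,t)) \<longlonglongrightarrow> l" using lim[of "(s,t)"] st by auto
    show ?thesis
    \<comment> \<open>A convergent sequence with values 0 and 1 is eventually constant; which value
      it takes is read off from the side of 1/2 on which the limit lies.\<close>
    proof (cases "l > 1/2")
      case True
      then have "\<forall>\<^sub>F n in sequentially. f (\<phi> n) (s,t) > 1/2"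
        using order_tendstoD(1)[OF l] by blast
      then have *: "\<forall>\<^sub>F n in sequentially. h (\<phi> n) s = h (\<phi> n) t"
        by eventually_elim (auto simp: f_def split: if_splits)
      then have "(s,t) \<in> r" using st by (simp add: r_def)
      then show ?thesis using * by simp
    next
      case False
      then have "\<forall>\<^sub>F n in sequentially. f (\<phi> n) (s,t) < 1" using order_tendstoD(2)[OF l] by simp
      then have *: "\<forall>\<^sub>F n in sequentially. h (\<phi> n) s \<noteq> h (\<phi> n) t"
        by eventually_elim (auto simp: f_def split: if_splits)
      have "(s,t) \<notin> r"
      proof
        assume "(s,t) \<in> r"
        then have "\<forall>\<^sub>F n in sequentially. h (\<phi> n) s = h (\<phi> n) t" by (simp add: r_def)
        with * have "\<forall>\<^sub>F n :: nat in sequentially. False" by eventually_elim simp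
        then show False by simp
      qed
      then show ?thesis using * by simp
    qed
  qed
  have "equiv S r"
  proof (rule equivI)
    show "trans r"
      unfolding r_def trans_def by (auto elim: eventually_elim2)
  qed (auto simp: r_def refl_on_def sym_def eq_commute)
  with \<phi> ev that show thesis by blast
qed

text \<open>A covering of \<open>M\<close> is pulled back to larger and larger balls about
  \<open>p\<close>. Each requirement on the limit relation involves finitely many net points, so it
  can be checked at one late stage, where these points are all mapped into \<open>M\<close>.\<close>

lemma asdim_le_of_large_balls:
  assumes pt: "point_transitive X" and nc: "net_compact X" and p: "p \<in> X"
    and balls: "\<And>k::nat. \<exists>y\<in>X. X \<inter> cball y (real k) \<subseteq> M"
    and M: "asdim_le M m"
  shows "asdim_le X m"
proof -
  obtain c \<Sigma> where c: "c \<ge> 0" and net: "net X c \<Sigma>" and fin: "\<And>x r. x \<in> X \<Longrightarrow> finite (cball x r \<inter> \<Sigma>)"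
    using nc unfolding net_compact_def by blast
  have \<Sigma>X: "\<Sigma> \<subseteq> X" using net by (simp add: net_def)
  have "\<Sigma> = (\<Union>n::nat. cball p (real n) \<inter> \<Sigma>)"
    by (auto simp: real_arch_simple)
  moreover have "countable (\<Union>n::nat. cball p (real n) \<inter> \<Sigma>)"
    using fin[OF p] by (intro countable_UN) (auto simp: countable_finite)
  ultimately have cnt: "countable \<Sigma>" by simp
  have "\<exists>f. isometric_on X f \<and> f ` X = X \<and> X \<inter> cball (f p) (real k) \<subseteq> M" for k
    using balls[of k] pt p unfolding point_transitive_def by metis
  then obtain f where f: "\<And>k. isometric_on X (f k)" "\<And>k. f k ` X = X"
    "\<And>k. X \<inter> cball (f k p) (real k) \<subseteq> M" by metis
  have df: "dist (f k x) (f k y) = dist x y" if "x \<in> X" "y \<in> X" for k x y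
    using f(1)[of k] that unfolding isometric_on_def by blast
  have fM: "f k s \<in> M" if "s \<in> \<Sigma>" "dist p s \<le> real k" for k s
  proof -
    have "s \<in> X" using that \<Sigma>X by blast
    then have "f k s \<in> X \<inter> cball (f k p) (real k)" using f(2)[of k] df[OF p, of s k] that by auto
    then show ?thesis using f(3)[of k] by blast
  qed
  show ?thesis
  proof (rule asdim_leI_net[OF net c])
    fix \<rho> :: real assume \<rho>: "\<rho> > 0"
    from M[unfolded asdim_le_def, rule_format, OF this]
    obtain \<U> where un: "\<Union>\<U> = M" and ub: "uniformly_bounded \<U>"
      and mult: "\<forall>x\<in>M. finite {U \<in> \<U>. U \<inter> cball x \<rho> \<noteq> {}} \<and>
        card {U \<in> \<U>. U \<inter> cball x \<rho> \<noteq> {}} \<le> m + 1"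
      by (elim exE conjE)
    obtain D where D: "\<And>U. U \<in> \<U> \<Longrightarrow> bounded U \<and> diameter U \<le> D"
      using ub unfolding uniformly_bounded_def by blast
    have "\<forall>x\<in>M. \<exists>U. U \<in> \<U> \<and> x \<in> U" using un by blast
    from bchoice[OF this] obtain u where u: "\<And>x. x \<in> M \<Longrightarrow> u x \<in> \<U> \<and> x \<in> u x"
      by blast
    \<comment> \<open>The colour of \<open>s\<close> at stage \<open>k\<close> is a chosen member of
      the covering containing \<open>f k s\<close>. It is arbitrary while \<open>f k s\<close> is
      outside \<open>M\<close>, which for fixed \<open>s\<close> happens only for finitely many
      \<open>k\<close>.\<close>
    define h where "h k s = u (f k s)" for k s
    obtain \<phi> r where \<phi>: "strict_mono (\<phi> :: nat \<Rightarrow> nat)" and eq: "equiv \<Sigma> r"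
      and ev: "\<And>s t. s \<in> \<Sigma> \<Longrightarrow> t \<in> \<Sigma> \<Longrightarrow>
        \<forall>\<^sub>F n in sequentially. (s,t) \<in> r \<longleftrightarrow> h (\<phi> n) s = h (\<phi> n) t"
      using colouring_limit[OF cnt, of h] by blast
    have evM: "\<forall>\<^sub>F n in sequentially. f (\<phi> n) s \<in> M" if "s \<in> \<Sigma>" for s
    proof -
      have "filterlim (\<lambda>n. real (\<phi> n)) at_top sequentially"
        using filterlim_compose[OF filterlim_real_sequentially filterlim_subseq[OF \<phi>]] .
      then have "\<forall>\<^sub>F n in sequentially. dist p s \<le> real (\<phi> n)"
        by (simp add: filterlim_at_top)
      then show ?thesis by eventually_elim (use fM that in auto)
    qed
    have "dist s t \<le> D" if st: "(s,t) \<in> r" for s t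
    proof -
      have s: "s \<in> \<Sigma>" "t \<in> \<Sigma>" using st eq by (auto simp: equiv_def refl_on_def)
      have "\<forall>\<^sub>F n in sequentially. f (\<phi> n) s \<in> M \<and> f (\<phi> n) t \<in> M \<and> h (\<phi> n) s = h (\<phi> n) t"
        using evM[OF s(1)] evM[OF s(2)] ev[OF s] by eventually_elim (use st in auto)
      then obtain n where n: "f (\<phi> n) s \<in> M" "f (\<phi> n) t \<in> M" "h (\<phi> n) s = h (\<phi> n) t"
        using eventually_happens'[OF sequentially_bot] by blast
      let ?U = "u (f (\<phi> n) s)"
      have "f (\<phi> n) s \<in> ?U" "f (\<phi> n) t \<in> ?U" "?U \<in> \<U>"
        using u[OF n(1)] u[OF n(2)] n(3) by (auto simp: h_def)
      then have "dist (f (\<phi> n) s) (f (\<phi> n) t) \<le> D"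
        using D[of ?U] diameter_bounded_bound[of ?U] by (meson order_trans)
      then show ?thesis using df[of s t "\<phi> n"] subsetD[OF \<Sigma>X] s by simp
    qed
    moreover have "\<exists>s\<in>T. \<exists>t\<in>T. s \<noteq> t \<and> (s,t) \<in> r"
      if T: "T \<subseteq> \<Sigma>" "finite T" "card T = m + 2" "\<And>s t. s \<in> T \<Longrightarrow> t \<in> T \<Longrightarrow> dist s t \<le> \<rho>" for T
    proof -
      \<comment> \<open>As \<open>T\<close> is finite, one stage realises the limit relation on all
        of \<open>T\<close>. There the colours are members meeting a single ball of radius
        \<open>\<rho>\<close>, so at most \<open>m + 1\<close> colours serve \<open>m + 2\<close>
        points.\<close>
      have "\<forall>\<^sub>F n in sequentially. (\<forall>s\<in>T. f (\<phi> n) s \<in> M) \<and>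
          (\<forall>s\<in>T. \<forall>t\<in>T. (s,t) \<in> r \<longleftrightarrow> h (\<phi> n) s = h (\<phi> n) t)"
        using T(2) by (intro eventually_conj eventually_ball_finite ballI evM ev subsetD[OF T(1)])
      from eventually_happens'[OF sequentially_bot this]
      obtain n where nM: "\<forall>s\<in>T. f (\<phi> n) s \<in> M"
        and nr: "\<forall>s\<in>T. \<forall>t\<in>T. (s,t) \<in> r \<longleftrightarrow> h (\<phi> n) s = h (\<phi> n) t"
        by (elim exE conjE)
      obtain t where t: "t \<in> T" using T(3) by fastforce
      have "h (\<phi> n) ` T \<subseteq> {U \<in> \<U>. U \<inter> cball (f (\<phi> n) t) \<rho> \<noteq> {}}"
      proof (rule image_subsetI)
        fix s assume s: "s \<in> T"
        have "dist (f (\<phi> n) t) (f (\<phi> n) s) \<le> \<rho>"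
          using df[of t s "\<phi> n"] s t T(4) subsetD[OF \<Sigma>X] subsetD[OF T(1)] by simp
        then show "h (\<phi> n) s \<in> {U \<in> \<U>. U \<inter> cball (f (\<phi> n) t) \<rho> \<noteq> {}}"
          using u[OF nM[rule_format, OF s]] by (auto simp: h_def)
      qed
      then have "card (h (\<phi> n) ` T) \<le> m + 1"
        using mult[rule_format, of "f (\<phi> n) t"] nM t by (meson card_mono order_trans)
      then have "\<not> inj_on (h (\<phi> n)) T" using T(3) card_image by fastforce
      then show ?thesis using nr unfolding inj_on_def by blast
    qed
    ultimately show "\<exists>r D. equiv \<Sigma> r \<and> (\<forall>(s,t)\<in>r. dist s t \<le> D) \<and>
      (\<forall>T\<subseteq>\<Sigma>. finite T \<and> card T = m + 2 \<and> (\<forall>s\<in>T. \<forall>t\<in>T. dist s t \<le> \<rho>) \<longrightarrow>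
        (\<exists>s\<in>T. \<exists>t\<in>T. s \<noteq> t \<and> (s,t) \<in> r))"
      using eq by (intro exI[of _ r] exI[of _ D]) auto
  qed
qed

section \<open>Bottlenecks prevent coarse separation\<close>

lemma unbounded_imp_dist_gt:
  assumes "\<not> bounded C"
  obtains x where "x \<in> C" "dist p x > r"
  using assms unfolding bounded_any_center[of _ p] by (auto simp: not_le)

text \<open>By the intermediate value theorem for the distance from \<open>p\<close>, a connected
  set reaching both sides of the sphere of radius \<open>u k\<close> contains \<open>q k\<close>.
  Two deep components would then share this point.\<close>

lemma not_coarsely_separates_bottleneck:
  assumes con: "connected M"
    and bottle: "\<And>k x. x \<in> M \<Longrightarrow> dist p x = u k \<Longrightarrow> x = q k"
    and u: "filterlim u at_top sequentially"
  shows "\<not> coarsely_separates K M"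
proof
  assume "coarsely_separates K M"
  then obtain R C D where C: "C \<in> components (M - nbhd M R K)"
    and D: "D \<in> components (M - nbhd M R K)"
    and ne: "C \<noteq> D" and dC: "deep M K C" and dD: "deep M K D"
    unfolding coarsely_separates_def by blast
  have CM: "C \<subseteq> M" "D \<subseteq> M" using in_components_subset C D by blast+
  show False
  proof (cases "K = {}")
    \<comment> \<open>The neighbourhood of the empty set is empty, and the connected set
      \<open>M\<close> does not have two components.\<close>
    case True
    then have "M - nbhd M R K = M" by (simp add: nbhd_def)
    then show False
      using C D ne con by (metis components_eq_sing_iff components_empty empty_iff singletonD)
  next
    case False
    then obtain a where a: "a \<in> K" by blast
    have unb: "\<not> bounded E" if E: "E \<subseteq> M" "deep M K E" for E
    proof
      assume "bounded E"
      then obtain e where e: "\<And>x. x \<in> E \<Longrightarrow> dist a x \<le> e"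
        unfolding bounded_any_center[of _ a] by blast
      \<comment> \<open>The maximum with 1 supplies the positive radius that \<open>deep\<close>
        asks for.\<close>
      have "E \<subseteq> nbhd M (max e 1) K"
        using E(1) e a infdist_le[OF a] by (force simp: nbhd_def dist_commute intro: order_trans)
      then show False using E(2) unfolding deep_def by (metis less_max_iff_disj zero_less_one)
    qed
    obtain x y where xy: "x \<in> C" "y \<in> D"
      using in_components_nonempty C D by blast
    \<comment> \<open>One sphere must enclose a point of each component, so that both have to cross
      it at the same \<open>q k\<close>.\<close>
    have "\<forall>\<^sub>F k in sequentially. max (dist p x) (dist p y) \<le> u k"
      using u by (simp only: filterlim_at_top)
    then obtain k where k: "dist p x \<le> u k" "dist p y \<le> u k"
      using eventually_happens'[OF sequentially_bot] by fastforce
    have hit: "q k \<in> E"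
      if E: "E \<subseteq> M" "deep M K E" "connected E" "z \<in> E" "dist p z \<le> u k" for E z
    proof -
      obtain w where w: "w \<in> E" "dist p w > u k"
        using unbounded_imp_dist_gt unb[OF E(1,2)] by blast
      have "connected (dist p ` E)"
        using E(3) by (intro connected_continuous_image continuous_intros)
      then have "u k \<in> dist p ` E"
        using connectedD_interval[of "dist p ` E" "dist p z" "dist p w" "u k"] E(4,5) w by auto
      then show ?thesis using bottle E(1) by force
    qed
    have "q k \<in> C \<inter> D"
      using hit[OF CM(1) dC in_components_connected[OF C] xy(1) k(1)]
        hit[OF CM(2) dD in_components_connected[OF D] xy(2) k(2)] by blast
    then show False using components_nonoverlap[OF C D] ne by blast
  qed
qed

section \<open>The geodesic with sparse balls attached\<close>

theorem theorem4p2: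
  fixes X :: "'a::metric_space set" and n :: nat
  assumes "point_transitive X"
    and "geodesic_space X"
    and "2 \<le> n"
    and "asdim X = enat n"
    and "net_compact X"
    and "has_infinite_geodesic X"
  shows "\<exists>M \<subseteq> X. asymptotic_Cantor_manifold n M"
proof -
  obtain g :: "real \<Rightarrow> 'a" where iso: "isometric_on {0..} g" and gX: "g ` {0..} \<subseteq> X"
    using assms(6) unfolding has_infinite_geodesic_def by blast
  have dg: "dist (g s) (g t) = dist s t" if "s \<ge> 0" "t \<ge> 0" for s t
    using iso that unfolding isometric_on_def by auto
  \<comment> \<open>Points of \<open>B j\<close> have distance from \<open>g 0\<close> between
    \<open>j*(j+1) + 1\<close> and \<open>(j+1)*(j+2) - 1\<close>, so the spheres of radius
    \<open>(k+1)*(k+2)\<close> avoid every ball.\<close>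
  define B where "B j = X \<inter> cball (g (real ((j+1)^2))) (real j)" for j :: nat
  define M where "M = g ` {0..} \<union> (\<Union>j. B j)"
  have gin: "g t \<in> X" if "t \<ge> 0" for t using gX that by auto
  have MX: "M \<subseteq> X" using gX by (auto simp: M_def B_def)
  have conM: "connected M"
  proof -
    have "continuous_on {0..} g"
      unfolding continuous_on_iff using dg by (metis atLeast_iff)
    then have "connected (g ` {0..})"
      by (intro connected_continuous_image) auto
    moreover have "connected (B j)" for j
      unfolding B_def by (intro connected_cball_geodesic_space assms(2) gin) simp
    moreover have "g ` {0..} \<inter> B j \<noteq> {}" for j
    proof -
      have "g (real ((j+1)^2)) \<in> g ` {0..} \<inter> B j"
        using gin[of "real ((j+1)^2)"] by (simp add: B_def)
      then show ?thesis by blast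
    qed
    ultimately have "connected (g ` {0..} \<union> B j)" for j
      by (intro connected_Un) auto
    then have "connected (\<Union>j. g ` {0..} \<union> B j)"
      by (intro connected_Union) auto
    moreover have "(\<Union>j. g ` {0..} \<union> B j) = M" by (auto simp: M_def)
    ultimately show ?thesis by simp
  qed
  have "asdim_le M m \<longleftrightarrow> asdim_le X m" for m
  proof
    have "\<exists>y\<in>X. X \<inter> cball y (real k) \<subseteq> M" for k :: nat
      using gin[of "real ((k+1)^2)"] by (force simp: M_def B_def)
    then show "asdim_le X m" if "asdim_le M m"
      using asdim_le_of_large_balls[OF assms(1,5) gin[of 0] _ that] by simp
  qed (rule asdim_le_subset[OF _ MX])
  then have "asdim M = enat n" using assms(4) by (simp add: asdim_def)
  moreover have "x = g (real ((k+1)*(k+2)))"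
    if x: "x \<in> M" and dx: "dist (g 0) x = real ((k+1)*(k+2))" for x k
    using x unfolding M_def
  proof
    assume "x \<in> g ` {0..}"
    then obtain t where "t \<ge> 0" "x = g t" by auto
    then show ?thesis using dx dg[of 0 t] by (simp add: dist_real_def)
  next
    assume "x \<in> (\<Union>j. B j)"
    then obtain j where j: "dist (g (real ((j+1)^2))) x \<le> real j" by (auto simp: B_def)
    have "dist (g 0) (g (real ((j+1)^2))) = real ((j+1)^2)"
      using dg[of 0 "real ((j+1)^2)"] by (simp add: dist_real_def)
    then have "real ((k+1)*(k+2)) \<le> real ((j+1)^2) + real j" "real ((j+1)^2) \<le> real ((k+1)*(k+2)) + real j"
      using j dx dist_triangle[of "g 0" x "g (real ((j+1)^2))"]
        dist_triangle2[of "g 0" "g (real ((j+1)^2))" x] by linarith+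
    then have le: "(k+1)*(k+2) \<le> (j+1)^2 + j" "(j+1)^2 \<le> (k+1)*(k+2) + j"
      by (simp_all only: of_nat_add[symmetric] of_nat_le_iff)
    have False
    \<comment> \<open>For \<open>j \<le> k\<close> the ball lies strictly inside the sphere, as
      \<open>(j+1)^2 + j = (j+1)*(j+2) - 1\<close>; for \<open>j > k\<close> strictly outside, as
      \<open>(j+1)^2 - j = j*(j+1) + 1\<close>.\<close>
    proof (cases "j \<le> k")
      case True
      then have "(j+1)*(j+2) \<le> (k+1)*(k+2)" by (intro mult_mono) auto
      with le(1) show False by (simp add: power2_eq_square)
    next
      case False
      then have "(k+1)*(k+2) \<le> j*(j+1)" by (intro mult_mono) auto
      with le(2) show False by (simp add: power2_eq_square)
    qed
    then show ?thesis ..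
  qed
  moreover have "filterlim (\<lambda>k. real ((k+1)*(k+2))) at_top sequentially"
    by (rule filterlim_at_top_mono[OF filterlim_real_sequentially]) (auto simp: algebra_simps)
  ultimately have "asymptotic_Cantor_manifold n M"
    unfolding asymptotic_Cantor_manifold_def
    using conM assms(3)
      not_coarsely_separates_bottleneck[of M "g 0" "\<lambda>k. real ((k+1)*(k+2))" "\<lambda>k. g (real ((k+1)*(k+2)))"]
    by blast
  with MX show ?thesis by blast
qed

end
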